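(* Let $m\ge 2$ be an integer and let $P_{2m}\subset\mathbb{E}^2$ be a centrally symmetric convex $2m$-gon. Then $$\tau(P_{2m})\ge \begin{cases} m-1, & \text{if } m \text{ is even},\\ m-2, & \text{if } m \text{ is odd}.\end{cases}$$
   Context: $\mathbb{E}^2$ is the Euclidean plane. A convex $2m$-gon is a compact convex polygon with nonempty interior and exactly $2m$ vertices (and $2m$ edges). For a convex body $K\subset\mathbb{E}^2$, $\mathrm{int}(K)$ denotes its interior. Let $X$ be a discrete multiset in $\mathbb{E}^2$ (points may be repeated; every bounded set contains only finitely many elements, counted with multiplicity) and let $k$ be a positive integer. $K+X$ is called a $k$-fold translative tiling of $\mathbb{E}^2$ if every point of $\mathbb{E}^2$ belongs to at least $k$ of the translates $K+\mathbf{x}$, $\mathbf{x}\in X$, and every point of $\mathbb{E}^2$ belongs to at most $k$ of the translates $\mathrm{int}(K)+\mathbf{x}$, $\mathbf{x}\in X$ (translates counted with multiplicity). For a centrally symmetric convex polygon $P$, $\tau(P)$ is the smallest positive integer $k$ such that there is a discrete multiset $X$ for which $P+X$ is a $k$-fold translative tiling of $\mathbb{E}^2$; $\tau(P)=\infty$ if no such $k$ exists. *)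

theory Defs
  imports "HOL-Analysis.Analysis"
begin

definition convex_polygon :: "nat \<Rightarrow> (real^2) set \<Rightarrow> bool" where
  "convex_polygon n P \<longleftrightarrow>
     polytope P \<and> interior P \<noteq> {} \<and> card {v. v extreme_point_of P} = n"

(* The centre of symmetry need not be the origin. *)
definition centrally_symmetric :: "(real^2) set \<Rightarrow> bool" where
  "centrally_symmetric P \<longleftrightarrow> (\<exists>c. \<forall>x\<in>P. 2 *\<^sub>R c - x \<in> P)"

(* A possibly infinite multiset of points is given by its multiplicity function; the library
   type of multisets only has finite ones.  Multiplicities are natural numbers, so in a bounded
   set the number of elements is finite even when counted with multiplicity. *)
definition discrete_multiset :: "(real^2 \<Rightarrow> nat) \<Rightarrow> bool" where
  "discrete_multiset X \<longleftrightarrow> (\<forall>B. bounded B \<longrightarrow> finite {x \<in> B. X x > 0})"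

(* The number, with multiplicity, of translates K + x that contain p.  It is meaningful for
   bounded K and discrete X, where the index set of the sum is finite
   (finite_translates_containing below). *)
definition cover_count :: "(real^2) set \<Rightarrow> (real^2 \<Rightarrow> nat) \<Rightarrow> real^2 \<Rightarrow> nat" where
  "cover_count K X p = (\<Sum>x | X x > 0 \<and> p \<in> (\<lambda>y. y + x) ` K. X x)"

lemma finite_translates_containing:
  assumes "bounded K" "discrete_multiset X"
  shows "finite {x. X x > 0 \<and> p \<in> (\<lambda>y. y + x) ` K}"
proof -
  have "bounded ((\<lambda>y. p - y) ` K)"
    using bounded_translation[OF bounded_uminus[THEN iffD2, OF assms(1)], of p]
    by (simp add: image_image)
  then have "finite {x \<in> (\<lambda>y. p - y) ` K. X x > 0}"
    using assms(2) unfolding discrete_multiset_def by blast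
  moreover have "{x. X x > 0 \<and> p \<in> (\<lambda>y. y + x) ` K} \<subseteq> {x \<in> (\<lambda>y. p - y) ` K. X x > 0}"
    by force
  ultimately show ?thesis
    by (rule rev_finite_subset)
qed

definition kfold_translative_tiling ::
    "nat \<Rightarrow> (real^2) set \<Rightarrow> (real^2 \<Rightarrow> nat) \<Rightarrow> bool" where
  "kfold_translative_tiling k K X \<longleftrightarrow>
     discrete_multiset X \<and>
     (\<forall>p. k \<le> cover_count K X p) \<and>
     (\<forall>p. cover_count (interior K) X p \<le> k)"

definition tau :: "(real^2) set \<Rightarrow> enat" where
  "tau P =
     (if \<exists>k>0. \<exists>X. kfold_translative_tiling k P X
      then enat (LEAST k. k > 0 \<and> (\<exists>X. kfold_translative_tiling k P X))
      else \<infinity>)"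

end

theory Submission imports Defs begin

text \<open>
  Centre \<open>P\<close> at the origin, fix a point \<open>v\<close> of the plane and give each \<open>p \<in> P\<close> the weight
  \<open>X (v - p)\<close>, the multiplicity of the tile in which \<open>v\<close> takes the position \<open>p\<close>. For a vertex \<open>q\<close>,
  moving \<open>v\<close> slightly parallel to a supporting line at \<open>q\<close> shows that the weight of the boundary
  points to the left of the line through \<open>q\<close> and \<open>- q\<close> is \<open>k - I\<close>, where \<open>I\<close> is the number of tiles
  containing \<open>v\<close> in their interior. Comparing \<open>q\<close> with \<open>- q\<close>, the weight \<open>w\<close> of the pair
  \<open>{q, - q}\<close> does not depend on \<open>q\<close>, and \<open>2 * k \<ge> 2 * I + (m - 1) * w\<close>.

  Let \<open>v\<close> be a vertex of a tile, so \<open>w \<ge> 1\<close>. If \<open>w \<ge> 2\<close> then \<open>k \<ge> m - 1\<close>. If \<open>w = 1\<close>, let \<open>g q\<close> be the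
  weight of the vertices to the left of the line through \<open>q\<close>; then \<open>g q + g (- q) = m - 1\<close>, and \<open>g\<close>
  changes by at most one along an edge of \<open>P\<close>. Hence some edge \<open>r s\<close> occurs at \<open>v\<close>
  such that at least \<open>m div 2 - 1\<close> tiles have \<open>v\<close> as a vertex strictly to the left of it. Since chords of
  \<open>P\<close> parallel to an edge are longer than the edge, all these tiles contain the tile vertex
  \<open>v + r - s\<close> in their interior, and the inequality above applied at \<open>v + r - s\<close> gives the bound.
\<close>

section \<open>Oriented area in the plane\<close>

definition cross2 :: "real^2 \<Rightarrow> real^2 \<Rightarrow> real" where
  "cross2 a b = a $ 1 * b $ 2 - a $ 2 * b $ 1"

lemma cross2_self [simp]: "cross2 a a = 0"
  by (simp add: cross2_def)

lemma cross2_commute: "cross2 b a = - cross2 a b"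
  by (simp add: cross2_def)

lemma cross2_simps [simp]:
  "cross2 (- a) b = - cross2 a b"
  "cross2 a (- b) = - cross2 a b"
  "cross2 a (b + c) = cross2 a b + cross2 a c"
  "cross2 (a + b) c = cross2 a c + cross2 b c"
  "cross2 a (b - c) = cross2 a b - cross2 a c"
  "cross2 a (t *\<^sub>R b) = t * cross2 a b"
  "cross2 (t *\<^sub>R a) b = t * cross2 a b"
  by (simp_all add: cross2_def algebra_simps)

text \<open>Cramer's rule for the basis \<open>a\<close>, \<open>b\<close>.\<close>

lemma cross2_decomposition:
  assumes "cross2 a b \<noteq> 0"
  obtains \<alpha> \<beta> where "p = \<alpha> *\<^sub>R a + \<beta> *\<^sub>R b"
proof
  have "cross2 a b *\<^sub>R p = cross2 p b *\<^sub>R a + cross2 a p *\<^sub>R b"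
    by (simp add: vec_eq_iff forall_2 cross2_def algebra_simps)
  then have "(1 / cross2 a b) *\<^sub>R (cross2 a b *\<^sub>R p)
      = (cross2 p b / cross2 a b) *\<^sub>R a + (cross2 a p / cross2 a b) *\<^sub>R b"
    by (simp add: scaleR_right_distrib)
  with assms show "p = (cross2 p b / cross2 a b) *\<^sub>R a + (cross2 a p / cross2 a b) *\<^sub>R b"
    by simp
qed

lemma cross2_eq_0D:
  assumes "cross2 a b = 0" "a \<noteq> 0"
  obtains t where "b = t *\<^sub>R a"
proof (cases "a $ 1 = 0")
  case True
  with assms have "a $ 2 \<noteq> 0" by (auto simp: vec_eq_iff forall_2)
  with True assms that[of "b $ 2 / a $ 2"] show ?thesis
    by (auto simp: vec_eq_iff forall_2 cross2_def)
next
  case False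
  with assms that[of "b $ 1 / a $ 1"] show ?thesis
    by (auto simp: vec_eq_iff forall_2 cross2_def field_simps)
qed

lemma exposing_functional:
  fixes P :: "'a::euclidean_space set"
  assumes "polyhedron P" "q extreme_point_of P"
  obtains n where "\<And>p. p \<in> P \<Longrightarrow> p \<noteq> q \<Longrightarrow> n \<bullet> p < n \<bullet> q"
proof -
  have "{q} exposed_face_of P"
    using assms by (simp add: exposed_face_of_polyhedron face_of_singleton)
  then obtain a b where ab: "P \<subseteq> {x. a \<bullet> x \<le> b}" "{q} = P \<inter> {x. a \<bullet> x = b}"
    unfolding exposed_face_of_def by blast
  show ?thesis
  proof (rule that[of a])
    fix p assume p: "p \<in> P" "p \<noteq> q"
    then have "a \<bullet> p \<noteq> b" "a \<bullet> p \<le> b" using ab by blast+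
    moreover have "a \<bullet> q = b" using ab by blast
    ultimately show "a \<bullet> p < a \<bullet> q" by simp
  qed
qed

section \<open>Convex polygons symmetric about the origin\<close>

locale symmetric_polygon =
  fixes P :: "(real^2) set"
  assumes polytope_P: "polytope P"
    and interior_nonempty: "interior P \<noteq> {}"
    and minus_mem: "x \<in> P \<Longrightarrow> - x \<in> P"
begin

abbreviation vertices :: "(real^2) set" where
  "vertices \<equiv> {v. v extreme_point_of P}"

lemma convex_P: "convex P" and closed_P: "closed P" and bounded_P: "bounded P"
  and polyhedron_P: "polyhedron P"
  using polytope_P
  by (auto simp: polytope_imp_convex polytope_imp_closed polytope_imp_bounded polytope_imp_polyhedron)

lemma finite_vertices: "finite vertices"
  using finite_polyhedron_extreme_points[OF polyhedron_P] by simp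

lemma vertex_mem: "q \<in> vertices \<Longrightarrow> q \<in> P"
  by (simp add: extreme_point_of_def)

lemma vertex_not_between:
  assumes "a \<in> P" "b \<in> P" "a \<noteq> b" "0 < t" "t < 1"
  shows "(1 - t) *\<^sub>R a + t *\<^sub>R b \<notin> vertices"
  using assms unfolding extreme_point_of_def mem_Collect_eq in_segment by blast

lemma minus_vertex:
  assumes "q \<in> vertices"
  shows "- q \<in> vertices"
proof -
  have "- q \<notin> open_segment a b" if "a \<in> P" "b \<in> P" for a b
  proof
    assume "- q \<in> open_segment a b"
    then obtain t where t: "a \<noteq> b" "0 < t" "t < 1" "- q = (1 - t) *\<^sub>R a + t *\<^sub>R b"
      by (auto simp: in_segment)
    then have "q = (1 - t) *\<^sub>R (- a) + t *\<^sub>R (- b)"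
      by (metis add.inverse_inverse minus_add_distrib scaleR_minus_right)
    with vertex_not_between[of "- a" "- b" t] that t assms minus_mem show False by auto
  qed
  with assms minus_mem show ?thesis by (auto simp: extreme_point_of_def)
qed

lemma interior_between:
  assumes "y \<in> interior P" "z \<in> P" "0 \<le> t" "t < 1"
  shows "(1 - t) *\<^sub>R y + t *\<^sub>R z \<in> interior P"
  using mem_interior_convex_shrink[OF convex_P assms(1,2), of "1 - t"] assms(3,4)
  by (simp add: algebra_simps)

lemma zero_interior: "0 \<in> interior P"
proof -
  obtain x where x: "x \<in> interior P" using interior_nonempty by blast
  then have "- x \<in> P" using interior_subset minus_mem by blast
  from interior_between[OF x this, of "1/2"] show ?thesis by simp
qed

lemma zero_mem: "0 \<in> P"
  using zero_interior interior_subset by blast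

lemma scale_mem:
  assumes "r \<in> P" "\<bar>a\<bar> \<le> 1"
  shows "a *\<^sub>R r \<in> P"
proof -
  have "\<bar>a\<bar> *\<^sub>R (sgn a *\<^sub>R r) + (1 - \<bar>a\<bar>) *\<^sub>R 0 \<in> P"
    using assms zero_mem minus_mem[of r] convexD[OF convex_P, of "sgn a *\<^sub>R r" 0 "\<bar>a\<bar>" "1 - \<bar>a\<bar>"]
    by (auto simp: sgn_if)
  then show ?thesis by (simp add: abs_mult_sgn)
qed

lemma combination_mem:
  assumes "r \<in> P" "s \<in> P" "\<bar>a\<bar> + \<bar>b\<bar> = 1"
  shows "a *\<^sub>R r + b *\<^sub>R s \<in> P"
proof -
  have "\<bar>a\<bar> *\<^sub>R (sgn a *\<^sub>R r) + \<bar>b\<bar> *\<^sub>R (sgn b *\<^sub>R s) \<in> P"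
    using assms by (intro convexD[OF convex_P] scale_mem) (auto simp: sgn_if)
  then show ?thesis by (simp add: abs_mult_sgn)
qed

text \<open>By \<open>combination_mem\<close>, \<open>P\<close> contains the (possibly degenerate)
  parallelogram spanned by \<open>r\<close>, \<open>s\<close>, \<open>- r\<close>,
  \<open>- s\<close>, and shrinking it towards 0 lands in the interior. The point in question mixes
  such an interior point, with weight \<open>t > 0\<close>, with \<open>z\<close>. Later proofs
  certify interior points in this way from coordinates alone.\<close>

lemma combination_interior:
  assumes "r \<in> P" "s \<in> P" "\<bar>a\<bar> + \<bar>b\<bar> < t" "t \<le> 1"  "z \<in> P"
  shows "a *\<^sub>R r + b *\<^sub>R s + (1 - t) *\<^sub>R z \<in> interior P"
proof -
  have t: "0 < t" using assms by linarith
  have inner: "x *\<^sub>R r + y *\<^sub>R s \<in> interior P" if "\<bar>x\<bar> + \<bar>y\<bar> < 1" for x y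
  proof (cases "\<bar>x\<bar> + \<bar>y\<bar> = 0")
    case True
    then have "x = 0" "y = 0" by linarith+
    then show ?thesis using zero_interior by simp
  next
    case False
    define c where "c = \<bar>x\<bar> + \<bar>y\<bar>"
    have c: "0 < c" "c < 1" using False that by (auto simp: c_def)
    have "(x / c) *\<^sub>R r + (y / c) *\<^sub>R s \<in> P"
      using c by (intro combination_mem assms) (simp add: c_def flip: add_divide_distrib)
    from interior_between[OF zero_interior this, of c] c show ?thesis
      by (simp add: scaleR_right_distrib)
  qed
  have "(a / t) *\<^sub>R r + (b / t) *\<^sub>R s \<in> interior P"
    using assms t by (intro inner) (simp flip: add_divide_distrib)
  from interior_between[OF this assms(5), of "1 - t"] t assms show ?thesis
    by (simp add: scaleR_right_distrib)
qed

lemma vertex_notin_interior: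
  assumes "q \<in> vertices"
  shows "q \<notin> interior P"
proof
  assume "q \<in> interior P"
  then show False
    using assms extreme_point_not_in_interior by blast
qed

lemma zero_not_vertex: "0 \<notin> vertices"
  using vertex_notin_interior zero_interior by blast

text \<open>Write \<open>p\<close> as \<open>b\<close> times \<open>q\<close>. If \<bar>b\<bar> < 1
  then \<open>p\<close> is interior; if \<bar>b\<bar> > 1 then \<open>q\<close> lies strictly
  between 0 and \<open>p\<close> or \<open>- p\<close>, so it is not extreme.\<close>

lemma vertex_line:
  assumes q: "q \<in> vertices" and p: "p \<in> P" "p \<notin> interior P" and c: "cross2 q p = 0"
  shows "p = q \<or> p = - q"
proof -
  obtain b where b: "p = b *\<^sub>R q"
    using cross2_eq_0D[OF c] q zero_not_vertex by auto
  have "\<not> \<bar>b\<bar> < 1"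
    using combination_interior[of q q b 0 1 q] b p vertex_mem[OF q] by auto
  moreover have "\<not> 1 < \<bar>b\<bar>"
  proof
    assume h: "1 < \<bar>b\<bar>"
    have "(1 / \<bar>b\<bar>) *\<^sub>R (sgn b *\<^sub>R p) = q"
      using h b by (auto simp: sgn_if)
    moreover have "sgn b *\<^sub>R p \<in> P" by (rule scale_mem[OF p(1)]) (simp add: sgn_if)
    moreover have "sgn b *\<^sub>R p \<noteq> 0"
      using h b q zero_not_vertex by (auto simp: sgn_if split: if_splits)
    ultimately show False
      using vertex_not_between[of 0 "sgn b *\<^sub>R p" "1 / \<bar>b\<bar>"] h zero_mem q by auto
  qed
  ultimately have "b = 1 \<or> b = - 1" by linarith
  with b show ?thesis by auto
qed

text \<open>The direction \<open>u\<close> is parallel to the supporting line at \<open>q\<close>.\<close>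

lemma vertex_direction:
  assumes q: "q \<in> vertices"
  obtains u where "0 < cross2 u q"
    and "\<And>p. p \<in> P \<Longrightarrow> p \<noteq> q \<Longrightarrow> cross2 u p < cross2 u q"
proof -
  obtain n where n: "\<And>p. p \<in> P \<Longrightarrow> p \<noteq> q \<Longrightarrow> n \<bullet> p < n \<bullet> q"
    using exposing_functional[OF polyhedron_P, of q] q by auto
  define u :: "real^2" where "u = vector [n $ 2, - n $ 1]"
  have "cross2 u p = n \<bullet> p" for p
    by (simp add: u_def cross2_def inner_vec_def sum_2 vector_2)
  with n[of 0] n zero_mem q zero_not_vertex show ?thesis
    by (intro that[of u]) auto
qed

text \<open>In coordinates along \<open>u\<close> and \<open>q\<close>, a boundary point other than
  \<open>q\<close> and \<open>- q\<close> sits beside an interior point \<beta> q on the same line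
  parallel to \<open>u\<close>. The shift moves it towards that point if \<open>p\<close> is to the
  left of \<open>q\<close>, and away from it if to the right. At \<open>q\<close> and
  \<open>- q\<close> the shift follows a supporting line that meets \<open>P\<close> nowhere
  else.\<close>

lemma eventually_shift:
  assumes q: "q \<in> vertices" and u: "0 < cross2 u q"
    and max: "\<And>p. p \<in> P \<Longrightarrow> p \<noteq> q \<Longrightarrow> cross2 u p < cross2 u q"
  shows "\<forall>\<^sub>F e in at_right 0.
    if p \<in> interior P \<or> p \<in> P \<and> cross2 q p > 0
    then p + e *\<^sub>R u \<in> interior P else p + e *\<^sub>R u \<notin> P"
proof -
  have lim: "((\<lambda>e. p + e *\<^sub>R u) \<longlongrightarrow> p + 0 *\<^sub>R u) (at_right 0)"
    by (intro tendsto_intros)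
  consider "p \<in> interior P" | "p \<notin> P" | "p \<in> P" "p \<notin> interior P"
    using interior_subset by blast
  then show ?thesis
  proof cases
    case 1
    then have "\<forall>\<^sub>F e in at_right 0. p + e *\<^sub>R u \<in> interior P"
      using lim by (intro topological_tendstoD) auto
    with 1 show ?thesis by simp
  next
    case 2
    then have "\<forall>\<^sub>F e in at_right 0. p + e *\<^sub>R u \<in> - P"
      using lim closed_P by (intro topological_tendstoD) auto
    moreover have "p \<notin> interior P" using 2 interior_subset by blast
    ultimately show ?thesis using 2 by simp
  next
    case 3
    obtain \<alpha> \<beta> where p: "p = \<alpha> *\<^sub>R u + \<beta> *\<^sub>R q"
      using cross2_decomposition[of u q] u by auto
    have qp: "cross2 q p = - \<alpha> * cross2 u q"
      using p by (simp add: cross2_commute[of q u])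
    have inside: "\<beta> *\<^sub>R q \<in> interior P" if "\<alpha> \<noteq> 0"
    proof -
      have ne: "cross2 q p \<noteq> 0" using qp that u by simp
      have "cross2 u p < cross2 u q" using max[of p] 3 ne by (cases "p = q") auto
      moreover have "cross2 u (- p) < cross2 u q"
        using max[of "- p"] 3 ne minus_mem[of p] by (cases "- p = q") auto
      ultimately have "\<bar>\<beta> * cross2 u q\<bar> < 1 * cross2 u q"
        using p by (simp only: cross2_simps cross2_self abs_less_iff) simp
      then have "\<bar>\<beta>\<bar> < 1" using u by (simp add: abs_mult)
      then show ?thesis
        using combination_interior[of q q \<beta> 0 1 q] vertex_mem[OF q] by auto
    qed
    consider "\<alpha> < 0" | "\<alpha> > 0" | "\<alpha> = 0" by linarith
    then show ?thesis
    proof cases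
      assume a: "\<alpha> < 0"
      have "\<forall>\<^sub>F e in at_right 0. e \<in> {0<..<- \<alpha>}"
        using a by (intro eventually_at_right_real) auto
      then have "\<forall>\<^sub>F e in at_right 0. p + e *\<^sub>R u \<in> interior P"
      proof eventually_elim
        case (elim e)
        \<comment> \<open>Solves for the convex combination of \<beta> q and \<open>p\<close> that
          equals the shifted point.\<close>
        define t where "t = 1 + e / \<alpha>"
        have "0 \<le> t" "t < 1" using elim a by (auto simp: t_def field_simps)
        from interior_between[OF inside _ this, of p] a 3
        have "(1 - t) *\<^sub>R \<beta> *\<^sub>R q + t *\<^sub>R p \<in> interior P" by simp
        moreover have "(1 - t) *\<^sub>R \<beta> *\<^sub>R q + t *\<^sub>R p = p + ((t - 1) * \<alpha>) *\<^sub>R u"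
          unfolding p by (simp add: algebra_simps)
        moreover have "(t - 1) * \<alpha> = e" using a by (simp add: t_def)
        ultimately show ?case by simp
      qed
      moreover have "cross2 q p > 0" using a u qp by (simp add: mult_neg_pos)
      ultimately show ?thesis using 3 by simp
    next
      assume a: "\<alpha> > 0"
      have "p + e *\<^sub>R u \<notin> P" if "e > 0" for e
      proof
        assume h: "p + e *\<^sub>R u \<in> P"
        \<comment> \<open>Now \<open>p\<close> lies strictly between \<beta> q and the shifted
          point, so it would be interior if the latter were in \<open>P\<close>.\<close>
        define t where "t = \<alpha> / (\<alpha> + e)"
        have t: "0 \<le> t" "t < 1" using that a by (auto simp: t_def field_simps)
        from interior_between[OF inside h t] a
        have "(1 - t) *\<^sub>R \<beta> *\<^sub>R q + t *\<^sub>R (p + e *\<^sub>R u) \<in> interior P" by simp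
        moreover have "(1 - t) *\<^sub>R \<beta> *\<^sub>R q + t *\<^sub>R (p + e *\<^sub>R u) = (t * (\<alpha> + e)) *\<^sub>R u + \<beta> *\<^sub>R q"
          unfolding p by (simp add: algebra_simps)
        moreover have "t * (\<alpha> + e) = \<alpha>" using a that by (simp add: t_def)
        ultimately show False using 3 p by simp
      qed
      then have "\<forall>\<^sub>F e in at_right 0. p + e *\<^sub>R u \<notin> P"
        by (auto simp: eventually_at_filter)
      moreover have "cross2 q p < 0" using a u qp by simp
      ultimately show ?thesis using 3 by simp
    next
      assume a: "\<alpha> = 0"
      then have pq: "p = q \<or> p = - q" using vertex_line[OF q 3] qp by simp
      have u0: "u \<noteq> 0" using u by (auto simp: cross2_def)
      have "p + e *\<^sub>R u \<notin> P" if "e > 0" for e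
      proof
        assume h: "p + e *\<^sub>R u \<in> P"
        show False
        proof (cases "p = q")
          case True
          with max[OF h] that u0 show False by simp
        next
          case False
          with pq have "p = - q" by simp
          with max[OF minus_mem[OF h]] that u0 show False by simp
        qed
      qed
      then have "\<forall>\<^sub>F e in at_right 0. p + e *\<^sub>R u \<notin> P"
        by (auto simp: eventually_at_filter)
      moreover have "cross2 q p = 0" using a qp by simp
      ultimately show ?thesis using 3 by simp
    qed
  qed
qed

section \<open>Edges and the vertices on either side of them\<close>

text \<open>Positivity of \<open>n \<bullet> r\<close> excludes the zero functional, which would
  make any two distinct vertices an edge.\<close>

definition edge :: "real^2 \<Rightarrow> real^2 \<Rightarrow> bool" where
  "edge r s \<longleftrightarrow> r \<in> vertices \<and> s \<in> vertices \<and> r \<noteq> s \<and>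
     (\<exists>n. 0 < n \<bullet> r \<and> n \<bullet> s = n \<bullet> r \<and> (\<forall>p\<in>vertices. n \<bullet> p \<le> n \<bullet> r))"

lemma edge_commute: "edge r s \<Longrightarrow> edge s r"
  unfolding edge_def by metis

lemma edge_minus:
  assumes "edge r s"
  shows "edge (- r) (- s)"
proof -
  obtain n where n: "r \<in> vertices" "s \<in> vertices" "r \<noteq> s" "0 < n \<bullet> r" "n \<bullet> s = n \<bullet> r"
      "\<forall>p\<in>vertices. n \<bullet> p \<le> n \<bullet> r"
    using assms unfolding edge_def by blast
  then have "- r \<in> vertices" "- s \<in> vertices" by (simp_all only: minus_vertex)
  moreover have "- n \<bullet> p \<le> - n \<bullet> - r" if "p \<in> vertices" for p
    using n(6)[rule_format, OF minus_vertex[OF that]] by simp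
  ultimately show ?thesis using n unfolding edge_def by (intro conjI exI[of _ "- n"] ballI) simp_all
qed

lemma edge_cross2:
  assumes "edge r s"
  shows "cross2 r s \<noteq> 0"
proof
  assume h: "cross2 r s = 0"
  obtain n where n: "r \<in> vertices" "s \<in> vertices" "r \<noteq> s" "0 < n \<bullet> r" "n \<bullet> s = n \<bullet> r"
    using assms unfolding edge_def by blast
  then have "s = r \<or> s = - r"
    using vertex_line[OF n(1) vertex_mem vertex_notin_interior h] by blast
  with n show False by auto
qed

text \<open>The functional of the edge forces \<open>a + b \<le> 1\<close>. Below 1 the point is
  interior by \<open>combination_interior\<close>; at 1 it lies inside the segment from
  \<open>r\<close> to \<open>s\<close>.\<close>

lemma edge_cone:
  assumes "edge r s" "0 < a" "0 < b"
  shows "a *\<^sub>R r + b *\<^sub>R s \<notin> vertices"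
proof
  assume p: "a *\<^sub>R r + b *\<^sub>R s \<in> vertices"
  obtain n where n: "r \<in> vertices" "s \<in> vertices" "r \<noteq> s" "0 < n \<bullet> r" "n \<bullet> s = n \<bullet> r"
      "\<forall>p\<in>vertices. n \<bullet> p \<le> n \<bullet> r"
    using assms unfolding edge_def by blast
  have "n \<bullet> (a *\<^sub>R r + b *\<^sub>R s) \<le> n \<bullet> r" using n p by blast
  then have "(a + b) * (n \<bullet> r) \<le> 1 * (n \<bullet> r)" using n by (simp add: inner_right_distrib distrib_right)
  then have "a + b \<le> 1" using n by simp
  then consider "a + b < 1" | "a = 1 - b" by linarith
  then show False
  proof cases
    case 1
    then show False
      using combination_interior[of r s a b 1 0] vertex_mem n zero_mem assms p vertex_notin_interior
      by auto
  next
    case 2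
    then show False using vertex_not_between[of r s b] vertex_mem n assms p by auto
  qed
qed

text \<open>Turning a line through the origin from \<open>r\<close> to \<open>s\<close> sweeps only
  the open cone of the edge and its opposite. By \<open>edge_cone\<close>, applied to
  \<open>p\<close> and \<open>- p\<close>, neither contains a vertex.\<close>

lemma edge_same_side:
  assumes e: "edge r s" "0 < cross2 r s" and p: "p \<in> vertices" "p \<noteq> r" "p \<noteq> - r" "p \<noteq> s" "p \<noteq> - s"
  shows "0 < cross2 r p \<longleftrightarrow> 0 < cross2 s p"
proof -
  have rs: "r \<in> vertices" "s \<in> vertices" using e unfolding edge_def by auto
  obtain a b where ab: "p = a *\<^sub>R r + b *\<^sub>R s"
    using cross2_decomposition[of r s] e by auto
  have cr: "cross2 r p = b * cross2 r s" and cs: "cross2 s p = - a * cross2 r s"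
    using ab by (simp_all add: cross2_commute[of s r])
  have "cross2 r p \<noteq> 0" "cross2 s p \<noteq> 0"
    using vertex_line rs p vertex_mem vertex_notin_interior by blast+
  then have nz: "a \<noteq> 0" "b \<noteq> 0" using cr cs by auto
  have "\<not> (0 < a \<and> 0 < b)" using edge_cone[OF e(1)] p ab by auto
  moreover have "- p = (- a) *\<^sub>R r + (- b) *\<^sub>R s" using ab by simp
  then have "\<not> (0 < - a \<and> 0 < - b)" using edge_cone[OF e(1)] minus_vertex[OF p(1)] by metis
  ultimately show ?thesis
    using nz cr cs e(2) by (auto simp: zero_less_mult_iff mult_less_0_iff)
qed

text \<open>The chord of \<open>P\<close> through \<open>p\<close> parallel to the edge is longer than the edge.\<close>

lemma edge_shift:
  assumes e: "edge r s" "0 < cross2 r s"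
    and p: "p \<in> vertices" "p \<noteq> s" "p \<noteq> - r" "0 < cross2 r p"
  shows "p + r - s \<in> interior P"
proof -
  obtain n where n: "r \<in> vertices" "s \<in> vertices" "r \<noteq> s" "0 < n \<bullet> r" "n \<bullet> s = n \<bullet> r"
      "\<forall>p\<in>vertices. n \<bullet> p \<le> n \<bullet> r"
    using e unfolding edge_def by blast
  obtain a b where ab: "p = a *\<^sub>R r + b *\<^sub>R s"
    using cross2_decomposition[of r s] e by auto
  have "p \<noteq> r" "p \<noteq> - s" using p e by auto
  then have "0 < cross2 s p" using edge_same_side[OF e p(1)] p by auto
  then have a: "a < 0" using ab e by (simp add: cross2_commute[of s r] mult_less_0_iff)
  have b: "0 < b" using p ab e by (simp add: zero_less_mult_iff)
  have P: "p \<in> P" "r \<in> P" "s \<in> P" "- r \<in> P" "- s \<in> P" "0 \<in> P"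
    using vertex_mem n p minus_mem zero_mem by blast+
  have "n \<bullet> p \<le> n \<bullet> r" "n \<bullet> (- p) \<le> n \<bullet> r" using n p minus_vertex by blast+
  then have "\<bar>n \<bullet> p\<bar> \<le> n \<bullet> r" by auto
  moreover have "n \<bullet> p = (a + b) * (n \<bullet> r)"
    using n ab by (simp add: inner_right_distrib distrib_right)
  ultimately have "\<bar>a + b\<bar> * (n \<bullet> r) \<le> 1 * (n \<bullet> r)" using n by (simp add: abs_mult)
  then have "\<bar>a + b\<bar> \<le> 1" using n by simp
  \<comment> \<open>Otherwise \<open>p\<close> is on the line of the edge beyond \<open>s\<close>,
    and \<open>t\<close> exhibits the vertex \<open>s\<close> between \<open>p\<close> and
    \<open>r\<close>.\<close>
  moreover have "a + b \<noteq> 1"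
  proof
    assume h: "a + b = 1"
    define t where "t = - a / b"
    have "0 < t" "t < 1" using a b h by (auto simp: t_def field_simps)
    then have "(1 - t) *\<^sub>R p + t *\<^sub>R r \<notin> vertices"
      using vertex_not_between P \<open>p \<noteq> r\<close> by blast
    moreover have "(1 - t) *\<^sub>R p + t *\<^sub>R r = ((1 - t) * a + t) *\<^sub>R r + ((1 - t) * b) *\<^sub>R s"
      by (simp add: ab algebra_simps)
    moreover have "1 - t = 1 / b" using b h by (simp add: t_def field_simps)
    ultimately show False using n b by (simp add: t_def)
  qed
  \<comment> \<open>Likewise on the opposite line, where \<open>- r\<close> would lie between
    \<open>p\<close> and \<open>- s\<close>.\<close>
  moreover have "a + b \<noteq> -1"
  proof
    assume h: "a + b = -1"
    define t where "t = b / (- a)"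
    have "0 < t" "t < 1" using a b h by (auto simp: t_def field_simps)
    then have "(1 - t) *\<^sub>R p + t *\<^sub>R (- s) \<notin> vertices"
      using vertex_not_between P \<open>p \<noteq> - s\<close> by blast
    moreover have "(1 - t) *\<^sub>R p + t *\<^sub>R (- s) = ((1 - t) * a) *\<^sub>R r + ((1 - t) * b - t) *\<^sub>R s"
      by (simp add: ab algebra_simps)
    moreover have "1 - t = 1 / (- a)" using a h by (simp add: t_def field_simps)
    ultimately show False using minus_vertex[of r] n a by (simp add: t_def)
  qed
  \<comment> \<open>Otherwise \<open>p\<close> lies in the parallelogram of
    \<open>combination_mem\<close>: either inside it or on its side from \<open>- r\<close> to
    \<open>s\<close>.\<close>
  moreover have "b - a > 1"
  proof (rule ccontr)
    assume "\<not> 1 < b - a"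
    then consider "b - a < 1" | "- a = 1 - b" by linarith
    then show False
    proof cases
      case 1
      then have "p \<in> interior P"
        using combination_interior[OF P(2,3), of a b 1 0] P(6) a b ab by simp
      then show False using p(1) vertex_notin_interior by blast
    next
      case 2
      then have "a = b - 1" by simp
      have "p = (1 - b) *\<^sub>R (- r) + b *\<^sub>R s"
        unfolding ab \<open>a = b - 1\<close> by (simp add: algebra_simps)
      moreover have "- r \<noteq> s" using n by auto
      ultimately show False using vertex_not_between[of "- r" s b] P(3,4) a b p(1) \<open>a = b - 1\<close> by auto
    qed
  qed
  ultimately have ab1: "\<bar>a + b\<bar> < 1" "b - a > 1" by auto
  \<comment> \<open>Use \<bar>x\<bar> + \<bar>y\<bar> = max(\<bar>x + y\<bar>, \<bar>x - y\<bar>)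
    for the coefficients \<open>t * a + 1\<close> and \<open>t * b - 1\<close>: their sum is
    \<open>t * (a + b)\<close>, their difference \<open>2 - t * (b - a)\<close>. If
    \<open>b - a < 2\<close>, then \<open>t = 1\<close> makes both small enough; otherwise this
    \<open>t\<close> cancels the difference.\<close>
  define t where "t = (if b - a < 2 then 1 else 2 / (b - a))"
  have "p + r - s = (t * a + 1) *\<^sub>R r + (t * b - 1) *\<^sub>R s + (1 - t) *\<^sub>R p"
    by (simp add: ab algebra_simps)
  also have "\<dots> \<in> interior P"
  proof (rule combination_interior[OF P(2,3) _ _ P(1)])
    show "t \<le> 1" using ab1 by (simp add: t_def field_simps)
    show "\<bar>t * a + 1\<bar> + \<bar>t * b - 1\<bar> < t"
    proof (cases "b - a < 2")
      case True
      then show ?thesis using ab1 by (simp add: t_def)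
    next
      case False
      then have d: "0 < b - a" by simp
      have "t * a + 1 = (a + b) / (b - a)" "t * b - 1 = (a + b) / (b - a)"
        using d False by (simp_all add: t_def field_simps)
      then have "\<bar>t * a + 1\<bar> + \<bar>t * b - 1\<bar> = 2 * \<bar>a + b\<bar> / (b - a)" using d by simp
      also have "\<dots> < 2 / (b - a)" using ab1 d by (simp add: divide_strict_right_mono)
      finally show ?thesis using False by (simp add: t_def)
    qed
  qed
  finally show ?thesis .
qed

text \<open>Deform a functional exposing a vertex of \<open>S\<close> into one exposing a vertex of \<open>T\<close>. By
  connectedness some intermediate functional is maximal at vertices of both kinds.\<close>

lemma edge_between:
  assumes ST: "S \<union> T = vertices" "S \<inter> T = {}" "S \<noteq> {}" "T \<noteq> {}" and card: "card vertices \<ge> 3"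
  obtains r s where "r \<in> S" "s \<in> T" "edge r s"
proof -
  \<comment> \<open>With \<open>z \<noteq> - q\<close> both exposing functionals are positive at
    \<open>q + z\<close>, so no functional on the way between them vanishes. A third vertex makes
    this choice possible.\<close>
  obtain q z where qz: "q \<in> S" "z \<in> T" "z \<noteq> - q"
  proof -
    obtain q z where qz: "q \<in> S" "z \<in> T" using ST by blast
    have "card {q, z} < card vertices"
      using card by (auto simp: card_insert_if)
    then obtain y where y: "y \<in> vertices" "y \<noteq> q" "y \<noteq> z"
      using card_mono[of "{q, z}" vertices] by fastforce
    show ?thesis
    proof (cases "z = - q")
      case True
      show ?thesis
      proof (cases "y \<in> S")
        case True
        then show ?thesis using that[of y z] y qz \<open>z = - q\<close> by auto
      next
        case False
        then show ?thesis using that[of q y] y qz \<open>z = - q\<close> ST by auto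
      qed
    qed (use that qz in blast)
  qed
  then have vert: "q \<in> vertices" "z \<in> vertices" using ST by auto
  obtain a where a: "\<And>p. p \<in> P \<Longrightarrow> p \<noteq> q \<Longrightarrow> a \<bullet> p < a \<bullet> q"
    using exposing_functional[OF polyhedron_P] vert by blast
  obtain b where b: "\<And>p. p \<in> P \<Longrightarrow> p \<noteq> z \<Longrightarrow> b \<bullet> p < b \<bullet> z"
    using exposing_functional[OF polyhedron_P] vert by blast
  define n where "n = (\<lambda>l::real. (1 - l) *\<^sub>R a + l *\<^sub>R b)"
  define C where "C U = {l \<in> {0..1}. \<exists>r\<in>U. \<forall>p\<in>vertices. n l \<bullet> p \<le> n l \<bullet> r}" for U
  have C_alt: "C U = (\<Union>r\<in>U. {0..1} \<inter> (\<Inter>p\<in>vertices. {l. n l \<bullet> p \<le> n l \<bullet> r}))" for U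
    by (auto simp: C_def)
  have closed: "closed (C U)" if "U \<subseteq> vertices" for U
  proof -
    have "finite U" using that finite_vertices finite_subset by blast
    then show ?thesis
      unfolding C_alt n_def
      by (intro closed_UN closed_Int closed_INT ballI closed_Collect_le continuous_intros) auto
  qed
  have "a \<bullet> p \<le> a \<bullet> q" "b \<bullet> p \<le> b \<bullet> z" if "p \<in> vertices" for p
    using a[of p] b[of p] vertex_mem[OF that] by (cases "p = q"; cases "p = z"; force)+
  then have "0 \<in> C S" "1 \<in> C T"
    using qz unfolding C_def n_def by auto
  moreover have "{0..1} \<subseteq> C S \<union> C T"
  proof
    fix l :: real assume l: "l \<in> {0..1}"
    have fin: "finite ((\<lambda>p. n l \<bullet> p) ` vertices)" "(\<lambda>p. n l \<bullet> p) ` vertices \<noteq> {}"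
      using finite_vertices vert by auto
    from Max_in[OF this] obtain r where r: "r \<in> vertices" "n l \<bullet> r = Max ((\<lambda>p. n l \<bullet> p) ` vertices)"
      by auto
    then have "\<forall>p\<in>vertices. n l \<bullet> p \<le> n l \<bullet> r" using fin by auto
    moreover have "r \<in> S \<or> r \<in> T" using r ST by blast
    ultimately show "l \<in> C S \<union> C T" using l unfolding C_def by blast
  qed
  moreover have "C S \<subseteq> {0..1}" "C T \<subseteq> {0..1}" by (auto simp: C_def)
  moreover have "closed (C S)" "closed (C T)" using closed ST by blast+
  ultimately have "C S \<inter> C T \<inter> {0..1} \<noteq> {}"
    using connected_closedD[of "{0..1::real}" "C S" "C T"] by (metis connected_Icc disjoint_iff subsetD)
  then obtain l where l: "l \<in> C S" "l \<in> C T" by blast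
  then obtain r s where rs: "r \<in> S" "s \<in> T" "\<forall>p\<in>vertices. n l \<bullet> p \<le> n l \<bullet> r"
      "\<forall>p\<in>vertices. n l \<bullet> p \<le> n l \<bullet> s" and l01: "0 \<le> l" "l \<le> 1"
    by (auto simp: C_def)
  have eq: "n l \<bullet> s = n l \<bullet> r" using rs ST by (metis UnI1 UnI2 order_antisym)
  have "- q \<in> P" "- z \<in> P" "- q \<noteq> z" "- z \<noteq> q"
    using vert vertex_mem minus_mem qz(3) by auto
  then have A: "0 < a \<bullet> (q + z)" "0 < b \<bullet> (q + z)"
    using a[of "- z"] b[of "- q"] by (simp_all add: inner_right_distrib)
  have "0 < (1 - l) * (a \<bullet> (q + z)) + l * (b \<bullet> (q + z))"
  proof (cases "l = 0")
    case False
    then have "0 < l * (b \<bullet> (q + z))" "0 \<le> (1 - l) * (a \<bullet> (q + z))"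
      using l01 A by auto
    then show ?thesis by linarith
  qed (use A in simp)
  then have "0 < n l \<bullet> (q + z)" by (simp only: n_def inner_add_left inner_scaleR_left)
  then have n0: "n l \<noteq> 0" by auto
  \<comment> \<open>A nonzero functional has positive maximum on \<open>P\<close>, because 0 is an
    interior point.\<close>
  have "P = convex hull vertices"
    using Krein_Milman_Minkowski[of P] convex_P bounded_P closed_P compact_eq_bounded_closed by blast
  also have "\<dots> \<subseteq> {x. n l \<bullet> x \<le> n l \<bullet> r}"
    using rs by (intro hull_minimal convex_halfspace_le) auto
  finally have "interior P \<subseteq> {x. n l \<bullet> x < n l \<bullet> r}"
    using interior_mono interior_halfspace_le[OF n0] by blast
  with zero_interior have pos: "0 < n l \<bullet> r" by auto
  have "edge r s"
    unfolding edge_def using pos eq rs(3) ST(1,2) rs(1,2) by (intro conjI exI[of _ "n l"]) auto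
  with rs(1,2) show ?thesis by (rule that)
qed

end

section \<open>Counting tiles by the position of a point in them\<close>

lemma mem_translate_iff: "p \<in> (\<lambda>y. y + x) ` K \<longleftrightarrow> p - x \<in> (K :: 'a::group_add set)"
  by (force simp: image_iff)

text \<open>The substitution p = v - x indexes a tile by the position that \<open>v\<close> takes in
  it, so counts at \<open>v\<close> become sums over points of \<open>K\<close>.\<close>

lemma cover_count_eq: "cover_count K X v = (\<Sum>p | p \<in> K \<and> 0 < X (v - p). X (v - p))"
  unfolding cover_count_def mem_translate_iff
  by (rule sum.reindex_bij_witness[of _ "\<lambda>p. v - p" "\<lambda>x. v - x"]) auto

lemma finite_cover:
  assumes "discrete_multiset X" "bounded K"
  shows "finite {p. p \<in> K \<and> 0 < X (v - p)}"
proof -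
  have "{p. p \<in> K \<and> 0 < X (v - p)} = (\<lambda>x. v - x) ` {x. X x > 0 \<and> v \<in> (\<lambda>y. y + x) ` K}"
    unfolding mem_translate_iff by (force simp: image_iff)
  with finite_translates_containing[OF assms(2,1)] show ?thesis by simp
qed

lemma cover_count_Un:
  assumes "discrete_multiset X" "bounded A" "bounded B" "A \<inter> B = {}"
  shows "cover_count (A \<union> B) X v = cover_count A X v + cover_count B X v"
proof -
  have "{p. p \<in> A \<union> B \<and> 0 < X (v - p)} = {p. p \<in> A \<and> 0 < X (v - p)} \<union> {p. p \<in> B \<and> 0 < X (v - p)}"
    by blast
  then show ?thesis
    unfolding cover_count_eq using assms by (subst sum.union_disjoint[symmetric]) (auto intro: finite_cover)
qed

lemma cover_count_mono:
  assumes "discrete_multiset X" "bounded B" "A \<subseteq> B"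
  shows "cover_count A X v \<le> cover_count B X v"
  unfolding cover_count_eq using assms by (intro sum_mono2 finite_cover) auto

lemma cover_count_finite:
  assumes "finite K"
  shows "cover_count K X v = (\<Sum>p\<in>K. X (v - p))"
  unfolding cover_count_eq using assms by (intro sum.mono_neutral_left) auto

section \<open>Local counts at a point of a multiple tiling\<close>

locale symmetric_polygon_tiling = symmetric_polygon +
  fixes k :: nat and X :: "real^2 \<Rightarrow> nat"
  assumes tiling: "kfold_translative_tiling k P X"
begin

lemma discrete_X: "discrete_multiset X"
  using tiling by (simp add: kfold_translative_tiling_def)

text \<open>Move \<open>v\<close> slightly in a direction parallel to a supporting line at \<open>q\<close>: the moved point
  lies on no tile boundary, so it is covered exactly \<open>k\<close> times.\<close>

lemma half_plane_count:
  assumes q: "q \<in> vertices"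
  shows "cover_count (interior P) X v + cover_count {p \<in> P - interior P. 0 < cross2 q p} X v = k"
proof -
  obtain u where u: "0 < cross2 u q" "\<And>p. p \<in> P \<Longrightarrow> p \<noteq> q \<Longrightarrow> cross2 u p < cross2 u q"
    using vertex_direction[OF q] by blast
  define K where "K = interior P \<union> {p \<in> P - interior P. 0 < cross2 q p}"
  obtain R where R: "\<And>p. p \<in> P \<Longrightarrow> norm p \<le> R"
    using bounded_P unfolding bounded_iff by blast
  \<comment> \<open>Only these finitely many tiles can contain \<open>v\<close> or a point
    \<open>v + e u\<close> with \<open>e < 1\<close>, so one small \<open>e\<close> serves all of
    them.\<close>
  define N where "N = {x \<in> cball v (R + norm u). X x > 0}"
  have "finite N"
    using discrete_X unfolding discrete_multiset_def N_def by blast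
  then have "\<forall>\<^sub>F e in at_right 0. \<forall>x\<in>N.
    if v - x \<in> interior P \<or> v - x \<in> P \<and> cross2 q (v - x) > 0
    then v - x + e *\<^sub>R u \<in> interior P else v - x + e *\<^sub>R u \<notin> P"
    by (intro eventually_ball_finite ballI eventually_shift[OF q u])
  moreover have "\<forall>\<^sub>F e in at_right (0::real). e \<in> {0<..<1}"
    by (rule eventually_at_right_real) simp
  ultimately have "\<forall>\<^sub>F e in at_right 0. e \<in> {0<..<1} \<and> (\<forall>x\<in>N.
    if v - x \<in> interior P \<or> v - x \<in> P \<and> cross2 q (v - x) > 0
    then v - x + e *\<^sub>R u \<in> interior P else v - x + e *\<^sub>R u \<notin> P)"
    by eventually_elim blast
  from eventually_happens'[OF trivial_limit_at_right_real this]
  obtain e :: real where e: "0 < e" "e < 1" and N: "\<forall>x\<in>N.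
    if v - x \<in> interior P \<or> v - x \<in> P \<and> cross2 q (v - x) > 0
    then v - x + e *\<^sub>R u \<in> interior P else v - x + e *\<^sub>R u \<notin> P"
    unfolding greaterThanLessThan_iff by blast
  have KP: "K \<subseteq> P" using interior_subset by (auto simp: K_def)
  have shift: "(v + e *\<^sub>R u - x \<in> P \<longleftrightarrow> v - x \<in> K) \<and> (v + e *\<^sub>R u - x \<in> interior P \<longleftrightarrow> v - x \<in> K)"
    if x: "X x > 0" for x
  proof (cases "x \<in> N")
    case True
    have *: "v + e *\<^sub>R u - x = v - x + e *\<^sub>R u" by simp
    from bspec[OF N True] show ?thesis
      unfolding * K_def using interior_subset[of P] by (auto split: if_splits)
  next
    case False
    then have far: "R + norm u < norm (v - x)" using x by (auto simp: N_def dist_norm)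
    have "norm (e *\<^sub>R u) \<le> norm u" using e by (simp add: mult_left_le_one_le)
    moreover have "norm (v - x) \<le> norm (v + e *\<^sub>R u - x) + norm (e *\<^sub>R u)"
      using norm_triangle_ineq4[of "v + e *\<^sub>R u - x" "e *\<^sub>R u"] by (simp add: algebra_simps)
    ultimately have "R < norm (v + e *\<^sub>R u - x)" using far by linarith
    then have "v + e *\<^sub>R u - x \<notin> P" using R by force
    moreover have "v - x \<notin> P" using R[of "v - x"] far norm_ge_zero[of u] by force
    ultimately show ?thesis using KP interior_subset by blast
  qed
  have "cover_count P X (v + e *\<^sub>R u) = cover_count K X v"
    unfolding cover_count_def mem_translate_iff using shift by (intro sum.cong) auto
  moreover have "cover_count (interior P) X (v + e *\<^sub>R u) = cover_count K X v"
    unfolding cover_count_def mem_translate_iff using shift by (intro sum.cong) auto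
  ultimately have "cover_count K X v = k"
    using tiling unfolding kfold_translative_tiling_def by (metis order_antisym)
  moreover have "bounded {p \<in> P - interior P. 0 < cross2 q p}"
    using bounded_P by (rule bounded_subset) auto
  ultimately show ?thesis
    unfolding K_def using bounded_P discrete_X
    by (subst (asm) cover_count_Un) (auto intro: bounded_interior)
qed

lemma vertex_neq_minus:
  assumes "q \<in> vertices"
  shows "q \<noteq> - q"
proof
  assume "q = - q"
  then have "2 *\<^sub>R q = 0" by (metis add.right_inverse scaleR_2)
  then show False using assms zero_not_vertex by simp
qed

text \<open>By \<open>vertex_line\<close>, only \<open>q\<close> and \<open>- q\<close> lie on the
  line through them. Stated for a general \<open>S\<close> so that it covers both the whole boundary
  and the vertex set.\<close>

lemma boundary_partition:
  assumes q: "q \<in> vertices" and S: "S \<subseteq> P - interior P" "q \<in> S" "- q \<in> S"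
  shows "S = ({p \<in> S. 0 < cross2 q p} \<union> {p \<in> S. 0 < cross2 (- q) p}) \<union> {q, - q}"
proof (rule set_eqI)
  fix p
  show "p \<in> S \<longleftrightarrow> p \<in> ({p \<in> S. 0 < cross2 q p} \<union> {p \<in> S. 0 < cross2 (- q) p}) \<union> {q, - q}"
  proof (cases "p \<in> S")
    case True
    then have "cross2 q p = 0 \<Longrightarrow> p = q \<or> p = - q" using vertex_line[OF q] S(1) by blast
    then show ?thesis using True by (cases "cross2 q p" "0 :: real" rule: linorder_cases) simp_all
  next
    case False
    with S show ?thesis by (metis (lifting) UnE insertE mem_Collect_eq singletonD)
  qed
qed

lemma vertices_boundary: "vertices \<subseteq> P - interior P"
  using vertex_mem vertex_notin_interior by blast

text \<open>Add \<open>half_plane_count\<close> for \<open>q\<close> and \<open>- q\<close>. The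
  right-hand side does not mention \<open>q\<close>, so the weight of an opposite pair is the same
  for all vertices.\<close>

lemma opposite_vertices_count:
  assumes q: "q \<in> vertices"
  shows "2 * k + (X (v - q) + X (v + q))
    = 2 * cover_count (interior P) X v + cover_count (P - interior P) X v"
proof -
  let ?A = "{p \<in> P - interior P. 0 < cross2 q p}"
  let ?B = "{p \<in> P - interior P. 0 < cross2 (- q) p}"
  have q': "- q \<in> vertices" "q \<noteq> - q" using minus_vertex[OF q] vertex_neq_minus[OF q] by auto
  have "P - interior P = (?A \<union> ?B) \<union> {q, - q}"
    using q q'(1) vertices_boundary by (intro boundary_partition) auto
  moreover have disjoint: "(?A \<union> ?B) \<inter> {q, - q} = {}" by auto
  moreover have "bounded ?A" "bounded ?B" "bounded (?A \<union> ?B)" "bounded {q, - q}"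
    using bounded_P by (auto intro: bounded_subset)
  ultimately have "cover_count (P - interior P) X v
      = cover_count (?A \<union> ?B) X v + cover_count {q, - q} X v"
    by (metis (lifting) cover_count_Un[OF discrete_X] disjoint)
  moreover have "cover_count (?A \<union> ?B) X v = cover_count ?A X v + cover_count ?B X v"
    using \<open>bounded ?A\<close> \<open>bounded ?B\<close> by (intro cover_count_Un[OF discrete_X]) auto
  moreover have "cover_count {q, - q} X v = X (v - q) + X (v + q)"
    using q'(2) by (subst cover_count_finite) auto
  ultimately show ?thesis
    using half_plane_count[OF q, of v] half_plane_count[OF q'(1), of v] by linarith
qed

text \<open>Pairing \<open>p\<close> with \<open>- p\<close> counts every vertex twice, and all
  pairs have equal weight.\<close>

lemma sum_vertices:
  assumes q: "q \<in> vertices" and card: "card vertices = 2 * m"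
  shows "(\<Sum>p\<in>vertices. X (v - p)) = m * (X (v - q) + X (v + q))"
proof -
  have "(\<Sum>p\<in>vertices. X (v + p)) = (\<Sum>p\<in>vertices. X (v - p))"
    by (rule sum.reindex_bij_witness[of _ uminus uminus]) (use minus_vertex in auto)
  then have "2 * (\<Sum>p\<in>vertices. X (v - p)) = (\<Sum>p\<in>vertices. X (v - p) + X (v + p))"
    by (simp add: sum.distrib)
  also have "\<dots> = (\<Sum>p\<in>vertices. X (v - q) + X (v + q))"
  proof (rule sum.cong)
    fix p assume "p \<in> vertices"
    then show "X (v - p) + X (v + p) = X (v - q) + X (v + q)"
      using opposite_vertices_count[of p v] opposite_vertices_count[OF q, of v] by linarith
  qed simp
  finally show ?thesis using card by simp
qed

text \<open>In \<open>opposite_vertices_count\<close>, bound the boundary weight below by that of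
  the vertices alone, which is \<open>m\<close> times the pair weight.\<close>

lemma vertex_bound:
  assumes q: "q \<in> vertices" and card: "card vertices = 2 * m"
  shows "2 * cover_count (interior P) X v + (m - 1) * (X (v - q) + X (v + q)) \<le> 2 * k"
proof -
  let ?w = "X (v - q) + X (v + q)"
  have "m * ?w = cover_count vertices X v"
    using sum_vertices[OF q card] by (simp only: cover_count_finite[OF finite_vertices])
  also have "\<dots> \<le> cover_count (P - interior P) X v"
    using bounded_P vertex_mem vertex_notin_interior
    by (intro cover_count_mono[OF discrete_X]) (auto intro: bounded_subset)
  finally show ?thesis
    using opposite_vertices_count[OF q, of v] half_plane_count[OF q, of v] by (cases m) simp_all
qed

section \<open>Vertex weights to the left of a diagonal\<close>

definition left_count :: "real^2 \<Rightarrow> real^2 \<Rightarrow> nat" where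
  "left_count v q = (\<Sum>p | p \<in> vertices \<and> 0 < cross2 q p. X (v - p))"

text \<open>\<open>left_count v\<close> is the \<open>g\<close> of the outline; with
  \<open>sum_vertices\<close> this yields the relation between its values at \<open>q\<close> and
  \<open>- q\<close>.\<close>

lemma left_count_opposite:
  assumes q: "q \<in> vertices"
  shows "left_count v q + left_count v (- q) + (X (v - q) + X (v + q)) = (\<Sum>p\<in>vertices. X (v - p))"
proof -
  have nz: "q \<noteq> - q" using vertex_neq_minus[OF q] .
  have "vertices = ({p \<in> vertices. 0 < cross2 q p} \<union> {p \<in> vertices. 0 < cross2 (- q) p}) \<union> {q, - q}"
    using q minus_vertex[OF q] vertices_boundary by (intro boundary_partition)
  then have "(\<Sum>p\<in>vertices. X (v - p))
    = (\<Sum>p\<in>({p \<in> vertices. 0 < cross2 q p} \<union> {p \<in> vertices. 0 < cross2 (- q) p}) \<union> {q, - q}. X (v - p))"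
    by (rule arg_cong)
  also have "\<dots> = (\<Sum>p\<in>{p \<in> vertices. 0 < cross2 q p} \<union> {p \<in> vertices. 0 < cross2 (- q) p}. X (v - p))
      + (\<Sum>p\<in>{q, - q}. X (v - p))"
    using finite_vertices by (intro sum.union_disjoint) auto
  also have "(\<Sum>p\<in>{p \<in> vertices. 0 < cross2 q p} \<union> {p \<in> vertices. 0 < cross2 (- q) p}. X (v - p))
      = left_count v q + left_count v (- q)"
    unfolding left_count_def using finite_vertices by (subst sum.union_disjoint) auto
  finally show ?thesis using nz by simp
qed

text \<open>Here \<open>d\<close> is the weight of the vertices to the left of \<open>r\<close>
  other than \<open>s\<close>. By \<open>edge_shift\<close> the tiles it counts contain
  \<open>v + r - s\<close> in their interior, and \<open>vertex_bound\<close> is applied at that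
  point.\<close>

lemma edge_counts:
  assumes e: "edge r s" "0 < cross2 r s" and card: "card vertices = 2 * m"
  shows "\<exists>d. left_count v r = d + X (v - s) \<and> left_count v s = d + X (v + r) \<and>
    (0 < X (v - s) + X (v + r) \<longrightarrow> 2 * d + (m - 1) \<le> 2 * k)"
proof -
  have rs: "r \<in> vertices" "s \<in> vertices" using e(1) by (auto simp: edge_def)
  let ?D = "{p \<in> vertices. 0 < cross2 r p \<and> p \<noteq> s}"
  define d where "d = (\<Sum>p\<in>?D. X (v - p))"
  have fin: "finite ?D" using finite_vertices by simp
  have "{p. p \<in> vertices \<and> 0 < cross2 r p} = insert s ?D" using e rs by auto
  then have 1: "left_count v r = d + X (v - s)"
    unfolding left_count_def d_def using fin by simp
  \<comment> \<open>Passing from \<open>r\<close> to \<open>s\<close> loses only \<open>s\<close>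
    and gains only \<open>- r\<close>.\<close>
  have "{p. p \<in> vertices \<and> 0 < cross2 s p} = insert (- r) ?D"
  proof -
    have "p \<in> vertices \<Longrightarrow> 0 < cross2 s p \<longleftrightarrow> p = - r \<or> 0 < cross2 r p \<and> p \<noteq> s" for p
      using edge_same_side[OF e, of p] e(2) cross2_commute[of r s]
      by (cases "p = r"; cases "p = - r"; cases "p = s"; cases "p = - s") auto
    then show ?thesis using minus_vertex[OF rs(1)] by blast
  qed
  then have 2: "left_count v s = d + X (v + r)"
    unfolding left_count_def d_def using fin by simp
  let ?v' = "v + r - s"
  have shift: "p + r - s \<in> interior P" if "p \<in> ?D" for p
    using edge_shift[OF e, of p] that by (cases "p = - r") auto
  have "d = (\<Sum>p\<in>(\<lambda>p. p + r - s) ` ?D. X (?v' - p))"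
    unfolding d_def by (subst sum.reindex) (auto simp: inj_on_def)
  also have "\<dots> = cover_count ((\<lambda>p. p + r - s) ` ?D) X ?v'"
    using fin by (simp add: cover_count_finite)
  also have "\<dots> \<le> cover_count (interior P) X ?v'"
    using shift
    by (intro cover_count_mono[OF discrete_X bounded_interior[OF bounded_P]]) blast
  finally have d: "d \<le> cover_count (interior P) X ?v'" .
  \<comment> \<open>A tile with \<open>s\<close> at \<open>v\<close> has \<open>r\<close> at the
    shifted point; one with \<open>- r\<close> at \<open>v\<close> has \<open>- s\<close> there.
    Either way the shifted point is a tile vertex.\<close>
  have 3: "2 * d + (m - 1) \<le> 2 * k" if pos: "0 < X (v - s) + X (v + r)"
  proof (cases "0 < X (v - s)")
    case True
    then have "(m - 1) * 1 \<le> (m - 1) * (X (?v' - r) + X (?v' + r))" by (intro mult_left_mono) auto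
    then show ?thesis using vertex_bound[OF rs(1) card, of ?v'] d by linarith
  next
    case False
    with pos have "(m - 1) * 1 \<le> (m - 1) * (X (?v' - (- s)) + X (?v' + (- s)))"
      by (intro mult_left_mono) auto
    then show ?thesis using vertex_bound[OF minus_vertex[OF rs(2)] card, of ?v'] d by linarith
  qed
  with 1 2 show ?thesis by (intro exI[of _ d]) blast
qed

lemma multiplicity_bound:
  assumes card: "card vertices = 2 * m" and m: "m \<ge> 2" and k: "0 < k"
  shows "(if even m then m - 1 else m - 2) \<le> k"
proof -
  have card3: "card vertices \<ge> 3" using card m by simp
  obtain q0 where q0: "q0 \<in> vertices"
    using card m by fastforce
  have "cover_count P X 0 \<noteq> 0"
    using tiling k unfolding kfold_translative_tiling_def by (metis gr_zeroI not_less0 order_less_le_trans)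
  then obtain x where x: "0 < X x"
    unfolding cover_count_def by (metis (mono_tags, lifting) mem_Collect_eq sum.neutral)
  define v where "v = x + q0"
  have v: "0 < X (v - q0)" using x by (simp add: v_def)
  define w where "w = X (v - q0) + X (v + q0)"
  have w_eq: "X (v - q) + X (v + q) = w" if "q \<in> vertices" for q
    using opposite_vertices_count[OF that, of v] opposite_vertices_count[OF q0, of v] unfolding w_def by linarith
  show ?thesis
  proof (cases "w = 1")
    case False
    with v have "(m - 1) * 2 \<le> (m - 1) * w" unfolding w_def by (intro mult_left_mono) auto
    then have "m - 1 \<le> k"
      using vertex_bound[OF q0 card, of v] unfolding w_def by linarith
    then show ?thesis by auto
  next
    case True
    have opp: "left_count v q + left_count v (- q) + 1 = m" if "q \<in> vertices" for q
      using left_count_opposite[OF that, of v] sum_vertices[OF q0 card, of v] w_eq[OF that] True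
      unfolding w_def by simp
    define t where "t = m div 2"
    have "\<exists>d. t \<le> d + 1 \<and> 2 * d + (m - 1) \<le> 2 * k"
    \<comment> \<open>Either \<open>left_count v\<close> crosses the level \<open>t\<close> along
      some edge, or it never falls below \<open>t\<close>.\<close>
    proof (cases "\<exists>q\<in>vertices. left_count v q < t")
      case True
      then obtain q where q: "q \<in> vertices" "left_count v q < t" by blast
      let ?S = "{q \<in> vertices. t \<le> left_count v q}" and ?T = "{q \<in> vertices. left_count v q < t}"
      have "t \<le> left_count v (- q)" using opp[OF q(1)] q(2) by (simp add: t_def)
      then have "- q \<in> ?S" "q \<in> ?T" using q minus_vertex by auto
      moreover have "?S \<union> ?T = vertices" "?S \<inter> ?T = {}" by auto
      ultimately obtain r s where rs: "r \<in> ?S" "s \<in> ?T" "edge r s"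
        using edge_between[of ?S ?T] card3 by blast
      have w1: "X (v - r) + X (v + r) = 1" "X (v - s) + X (v + s) = 1"
        using w_eq rs \<open>w = 1\<close> by auto
      consider "0 < cross2 r s" | "0 < cross2 s r"
        using edge_cross2[OF rs(3)] cross2_commute[of r s] by linarith
      then show ?thesis
      proof cases
        case 1
        from edge_counts[OF rs(3) 1 card, of v]
        obtain d where d: "left_count v r = d + X (v - s) \<and> left_count v s = d + X (v + r) \<and>
            (0 < X (v - s) + X (v + r) \<longrightarrow> 2 * d + (m - 1) \<le> 2 * k)" ..
        \<comment> \<open>The drop from \<open>r\<close> to \<open>s\<close> forces
          \<open>X (v - s) = 1\<close> and \<open>X (v + r) = 0\<close>, so \<open>d\<close> is one
          less than the value at \<open>r\<close>.\<close>
        with rs w1 have "0 < X (v - s)" "t \<le> d + 1" by auto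
        with d show ?thesis by auto
      next
        case 2
        from edge_counts[OF edge_commute[OF rs(3)] 2 card, of v]
        obtain d where d: "left_count v s = d + X (v - r) \<and> left_count v r = d + X (v + s) \<and>
            (0 < X (v - r) + X (v + s) \<longrightarrow> 2 * d + (m - 1) \<le> 2 * k)" ..
        with rs w1 have "0 < X (v + s)" "t \<le> d + 1" by auto
        with d show ?thesis by auto
      qed
    next
      case False
      \<comment> \<open>By \<open>opp\<close> this happens only for odd \<open>m\<close> with
        \<open>left_count v\<close> constant. Any edge then works, up to replacing it by its
        opposite, since exactly one of \<open>s\<close> and \<open>- s\<close> occurs at
        \<open>v\<close>.\<close>
      then have ge: "t \<le> left_count v q" if "q \<in> vertices" for q using that by force
      have "{q0} \<union> (vertices - {q0}) = vertices" "{q0} \<inter> (vertices - {q0}) = {}" using q0 by auto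
      moreover have "vertices - {q0} \<noteq> {}" using minus_vertex[OF q0] vertex_neq_minus[OF q0] by force
      ultimately obtain s where s: "edge q0 s"
        using edge_between[of "{q0}" "vertices - {q0}"] card3 by blast
      obtain r s where rs: "edge r s" "0 < cross2 r s"
      proof (cases "0 < cross2 q0 s")
        case True
        then show ?thesis using s that by blast
      next
        case False
        then have "0 < cross2 s q0" using edge_cross2[OF s] cross2_commute[of q0 s] by linarith
        then show ?thesis using edge_commute[OF s] that by blast
      qed
      then have vert: "r \<in> vertices" "s \<in> vertices" by (auto simp: edge_def)
      show ?thesis
      proof (cases "0 < X (v - s) + X (v + r)")
        case True
        from edge_counts[OF rs card, of v]
        obtain d where "left_count v r = d + X (v - s) \<and> left_count v s = d + X (v + r) \<and>
            (0 < X (v - s) + X (v + r) \<longrightarrow> 2 * d + (m - 1) \<le> 2 * k)" ..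
        moreover have "X (v - s) \<le> 1" using w_eq[OF vert(2)] \<open>w = 1\<close> by linarith
        ultimately show ?thesis using ge[OF vert(1)] True by (intro exI[of _ d]) auto
      next
        case False
        then have pos: "X (v + s) = 1" using w_eq[OF vert(2)] \<open>w = 1\<close> by simp
        have "0 < cross2 (- r) (- s)" using rs(2) by simp
        from edge_counts[OF edge_minus[OF rs(1)] this card, of v]
        obtain d where "left_count v (- r) = d + X (v - - s) \<and> left_count v (- s) = d + X (v + - r) \<and>
            (0 < X (v - - s) + X (v + - r) \<longrightarrow> 2 * d + (m - 1) \<le> 2 * k)" ..
        then show ?thesis using ge[OF minus_vertex[OF vert(1)]] pos by (intro exI[of _ d]) auto
      qed
    qed
    then obtain d where "t \<le> d + 1" "2 * d + (m - 1) \<le> 2 * k" by blast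
    \<comment> \<open>For even \<open>m\<close> this reads 2m - 3 \<le> 2k, and parity rounds it up
      to m - 1 \<le> k; for odd \<open>m\<close> it reads 2m - 4 \<le> 2k.\<close>
    then show ?thesis unfolding t_def using m by (auto elim!: evenE oddE)
  qed
qed

end

section \<open>Reduction to a polygon centred at the origin\<close>

lemma cover_count_translation:
  "cover_count ((+) a ` K) X v = cover_count K X (v - a)"
proof -
  have "v \<in> (\<lambda>y. y + x) ` (+) a ` K \<longleftrightarrow> v - a \<in> (\<lambda>y. y + x) ` K" for x
    by (force simp: image_iff algebra_simps)
  then show ?thesis unfolding cover_count_def by simp
qed

lemma kfold_translative_tiling_translation:
  assumes "kfold_translative_tiling k K X"
  shows "kfold_translative_tiling k ((+) a ` K) X"
  using assms unfolding kfold_translative_tiling_def interior_translation cover_count_translation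
  by simp

theorem theorem1:
  fixes m :: nat and P :: "(real^2) set"
  assumes "m \<ge> 2"
    and "convex_polygon (2 * m) P"
    and "centrally_symmetric P"
  shows "tau P \<ge> enat (if even m then m - 1 else m - 2)"
proof -
  obtain c where c: "\<And>x. x \<in> P \<Longrightarrow> 2 *\<^sub>R c - x \<in> P"
    using assms(3) unfolding centrally_symmetric_def by blast
  \<comment> \<open>Translating the tile only translates the whole covering pattern, so the same
    \<open>X\<close> serves for \<open>Q\<close>.\<close>
  define Q where "Q = (+) (- c) ` P"
  have P: "polytope P" "interior P \<noteq> {}" "card {v. v extreme_point_of P} = 2 * m"
    using assms(2) by (auto simp: convex_polygon_def)
  have Q: "symmetric_polygon Q"
  proof
    show "polytope Q" using P(1) by (simp only: Q_def polytope_translation_eq)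
    show "interior Q \<noteq> {}" unfolding Q_def interior_translation using P(2) by simp
    show "- x \<in> Q" if x: "x \<in> Q" for x
    proof -
      obtain y where y: "y \<in> P" "x = y - c" using x by (auto simp: Q_def)
      have "- x = - c + (2 *\<^sub>R c - y)" using y by (simp add: scaleR_2)
      with c[OF y(1)] show ?thesis unfolding Q_def by blast
    qed
  qed
  have "{v. v extreme_point_of Q} = (+) (- c) ` {v. v extreme_point_of P}"
    unfolding Q_def by (rule extreme_points_of_translation)
  then have card: "card {v. v extreme_point_of Q} = 2 * m"
    using P(3) by (simp add: card_image)
  have bound: "(if even m then m - 1 else m - 2) \<le> k"
    if "k > 0" "kfold_translative_tiling k P X" for k X
  proof -
    have "kfold_translative_tiling k Q X"
      unfolding Q_def by (rule kfold_translative_tiling_translation) fact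
    with Q interpret symmetric_polygon_tiling Q k X
      by (simp add: symmetric_polygon_tiling_def symmetric_polygon_tiling_axioms_def)
    show ?thesis by (rule multiplicity_bound[OF card assms(1) that(1)])
  qed
  show ?thesis
  proof (cases "\<exists>k>0. \<exists>X. kfold_translative_tiling k P X")
    case True
    define l where "l = (LEAST k. k > 0 \<and> (\<exists>X. kfold_translative_tiling k P X))"
    have "l > 0 \<and> (\<exists>X. kfold_translative_tiling l P X)"
      unfolding l_def by (rule LeastI_ex) (use True in blast)
    then have "(if even m then m - 1 else m - 2) \<le> l" using bound by blast
    moreover have "tau P = enat l" using True by (simp add: tau_def l_def)
    ultimately show ?thesis by simp
  next
    case False
    then have "tau P = \<infinity>" unfolding tau_def by (rule if_not_P)
    then show ?thesis by simp
  qed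
qed

end
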